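(* Let $\mathcal{S}=\langle\mathcal{L},\vdash\rangle$ be a monotonic logic, where $\mathcal{L}$ is the formula algebra over a denumerable set of variables $V$ in a signature containing a unary operator $\neg$. Suppose there exists $\alpha\in\mathcal{L}$ such that $C_\vdash(\{\alpha\})=\mathcal{L}$. If $\neg$-ECQ holds in $\mathcal{S}$, then spECQ and pfECQ also hold in $\mathcal{S}$.
   Context: A logic is a pair $\langle\mathcal{L},\vdash\rangle$ with $\vdash\,\subseteq\mathcal{P}(\mathcal{L})\times\mathcal{L}$; $C_\vdash(\Gamma)=\{\alpha:\Gamma\vdash\alpha\}$. Monotonic: $\Gamma\subseteq\Sigma$ implies $C_\vdash(\Gamma)\subseteq C_\vdash(\Sigma)$. $\neg$-ECQ: for every $\varphi\in\mathcal{L}$, $C_\vdash(\{\varphi,\neg\varphi\})=\mathcal{L}$. spECQ: for every $\Gamma\subsetneq\mathcal{L}$ there is $\varphi\in\mathcal{L}$ with $\Gamma\cup\{\varphi\}\subsetneq\mathcal{L}$ and $C_\vdash(\Gamma\cup\{\varphi\})=\mathcal{L}$. pfECQ: for every $\Gamma\subsetneq\mathcal{L}$ there is $\Delta\subsetneq\mathcal{L}$ with $\Gamma\subseteq\Delta$ and $C_\vdash(\Delta)=\mathcal{L}$. *)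

theory Defs
  imports Main "HOL-Library.Countable_Set"
begin

datatype ('f, 'v) fm = Var 'v | Op 'f "('f, 'v) fm list"

text \<open>A signature is a set of pairs (operation symbol, arity).\<close>

inductive_set formulas :: "('f \<times> nat) set \<Rightarrow> 'v set \<Rightarrow> ('f, 'v) fm set"
  for F :: "('f \<times> nat) set" and V :: "'v set" where
  Var: "v \<in> V \<Longrightarrow> Var v \<in> formulas F V"
| Op: "(f, length ts) \<in> F \<Longrightarrow> (\<And>t. t \<in> set ts \<Longrightarrow> t \<in> formulas F V) \<Longrightarrow> Op f ts \<in> formulas F V"

definition logic :: "'a set \<Rightarrow> ('a set \<times> 'a) set \<Rightarrow> bool" where
  "logic L E \<longleftrightarrow> E \<subseteq> Pow L \<times> L"

definition Cn :: "('a set \<times> 'a) set \<Rightarrow> 'a set \<Rightarrow> 'a set" where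
  "Cn E \<Gamma> = {\<alpha>. (\<Gamma>, \<alpha>) \<in> E}"

definition monotonic :: "'a set \<Rightarrow> ('a set \<times> 'a) set \<Rightarrow> bool" where
  "monotonic L E \<longleftrightarrow> (\<forall>\<Gamma> \<Sigma>. \<Gamma> \<subseteq> \<Sigma> \<and> \<Sigma> \<subseteq> L \<longrightarrow> Cn E \<Gamma> \<subseteq> Cn E \<Sigma>)"

definition neg_ECQ :: "('a \<Rightarrow> 'a) \<Rightarrow> 'a set \<Rightarrow> ('a set \<times> 'a) set \<Rightarrow> bool" where
  "neg_ECQ ng L E \<longleftrightarrow> (\<forall>\<phi>\<in>L. Cn E {\<phi>, ng \<phi>} = L)"

definition spECQ :: "'a set \<Rightarrow> ('a set \<times> 'a) set \<Rightarrow> bool" where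
  "spECQ L E \<longleftrightarrow> (\<forall>\<Gamma>. \<Gamma> \<subset> L \<longrightarrow> (\<exists>\<phi>\<in>L. \<Gamma> \<union> {\<phi>} \<subset> L \<and> Cn E (\<Gamma> \<union> {\<phi>}) = L))"

definition pfECQ :: "'a set \<Rightarrow> ('a set \<times> 'a) set \<Rightarrow> bool" where
  "pfECQ L E \<longleftrightarrow> (\<forall>\<Gamma>. \<Gamma> \<subset> L \<longrightarrow> (\<exists>\<Delta>. \<Delta> \<subset> L \<and> \<Gamma> \<subseteq> \<Delta> \<and> Cn E \<Delta> = L))"

end

theory Submission
  imports Defs
begin

text \<open>Let \<open>\<alpha>\<close> be explosive. If \<open>\<Gamma> \<union> {\<alpha>}\<close> is proper, it is the required extension of \<open>\<Gamma>\<close>.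
  Otherwise \<open>\<Gamma>\<close> misses only \<open>\<alpha>\<close>; as there are infinitely many variables, \<open>\<Gamma>\<close> contains some
  variable together with its negation and so is itself explosive.\<close>

text \<open>Transports explosion twice below: from \<open>{\<alpha>}\<close> to
  \<open>\<Gamma> \<union> {\<alpha>}\<close>, and from a contradictory pair to
  \<open>\<Gamma>\<close>.\<close>

lemma Cn_eq_superset:
  assumes "logic L E" and "monotonic L E"
    and "Cn E \<Gamma> = L" and "\<Gamma> \<subseteq> \<Sigma>" and "\<Sigma> \<subseteq> L"
  shows "Cn E \<Sigma> = L"
proof
  show "Cn E \<Sigma> \<subseteq> L"
    using assms(1) by (auto simp: logic_def Cn_def)
  show "L \<subseteq> Cn E \<Sigma>"
    using assms(2-5) by (metis monotonic_def)
qed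

lemma spECQ_imp_pfECQ:
  assumes "spECQ L E"
  shows "pfECQ L E"
  unfolding pfECQ_def
proof (intro allI impI)
  fix \<Gamma> assume "\<Gamma> \<subset> L"
  with assms obtain \<phi> where "\<Gamma> \<union> {\<phi>} \<subset> L" and "Cn E (\<Gamma> \<union> {\<phi>}) = L"
    by (meson spECQ_def)
  then show "\<exists>\<Delta>. \<Delta> \<subset> L \<and> \<Gamma> \<subseteq> \<Delta> \<and> Cn E \<Delta> = L"
    by (intro exI[of _ "\<Gamma> \<union> {\<phi>}"]) (simp add: subset_insertI)
qed

text \<open>Here \<open>L\<close> is an arbitrary set: the structure of formulas enters only through
  one pair \<open>\<phi>\<close>, \<open>ng \<phi>\<close> that avoids
  \<open>\<alpha>\<close>.\<close>

lemma spECQ_if_neg_ECQ: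
  assumes "logic L E" and "monotonic L E"
    and "\<alpha> \<in> L" and "Cn E {\<alpha>} = L"
    and "neg_ECQ ng L E"
    and "\<phi> \<in> L" and "ng \<phi> \<in> L" and "\<phi> \<noteq> \<alpha>" and "ng \<phi> \<noteq> \<alpha>"
  shows "spECQ L E"
  unfolding spECQ_def
proof (intro allI impI)
  fix \<Gamma> assume \<Gamma>: "\<Gamma> \<subset> L"
  show "\<exists>\<psi>\<in>L. \<Gamma> \<union> {\<psi>} \<subset> L \<and> Cn E (\<Gamma> \<union> {\<psi>}) = L"
  proof (cases "\<Gamma> \<union> {\<alpha>} = L")
    case False
    then have "\<Gamma> \<union> {\<alpha>} \<subset> L"
      using \<Gamma> assms(3) by blast
    moreover from this have "Cn E (\<Gamma> \<union> {\<alpha>}) = L"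
      by (intro Cn_eq_superset[OF assms(1,2,4)]) auto
    ultimately show ?thesis
      using assms(3) by (intro bexI[of _ \<alpha>] conjI)
  next
    case True
    \<comment> \<open>In this case \<open>\<Gamma>\<close> contains every element of
      \<open>L\<close> other than \<open>\<alpha>\<close>.\<close>
    then have sub: "{\<phi>, ng \<phi>} \<subseteq> \<Gamma>"
      using assms(6-9) by blast
    have "Cn E {\<phi>, ng \<phi>} = L"
      using assms(5,6) by (simp add: neg_ECQ_def)
    then have "Cn E \<Gamma> = L"
      using sub psubset_imp_subset[OF \<Gamma>] by (rule Cn_eq_superset[OF assms(1,2)])
    \<comment> \<open>An element already in \<open>\<Gamma>\<close> serves as witness, so the
      extension stays proper.\<close>
    moreover have "\<Gamma> \<union> {\<phi>} = \<Gamma>"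
      using sub by blast
    ultimately show ?thesis
      using \<Gamma> assms(6) by (intro bexI[of _ \<phi>]) simp_all
  qed
qed

text \<open>Constructors are injective, so each equation with \<open>\<alpha>\<close> rules out at
  most one variable.\<close>

lemma exists_fresh_Var:
  assumes "infinite V"
  obtains v where "v \<in> V" and "Var v \<noteq> \<alpha>" and "Op f [Var v] \<noteq> \<alpha>"
proof -
  \<comment> \<open>A \<open>THE\<close> without a solution is some unspecified value; this only
    enlarges the finite bound.\<close>
  have "{v \<in> V. Var v = \<alpha> \<or> Op f [Var v] = \<alpha>} \<subseteq> {THE v. Var v = \<alpha>, THE v. Op f [Var v] = \<alpha>}"
    by auto
  then have "finite {v \<in> V. Var v = \<alpha> \<or> Op f [Var v] = \<alpha>}"
    by (rule finite_subset) simp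
  then have "V \<noteq> {v \<in> V. Var v = \<alpha> \<or> Op f [Var v] = \<alpha>}"
    using assms by metis
  then show thesis
    using that by blast
qed

theorem theorem3p26:
  fixes F :: "('f \<times> nat) set" and neg :: 'f and V :: "'v set"
    and L :: "('f, 'v) fm set" and E :: "(('f, 'v) fm set \<times> ('f, 'v) fm) set"
  assumes "countable V" and "infinite V"
    and "(neg, 1) \<in> F"
    and "L = formulas F V"
    and "logic L E"
    and "monotonic L E"
    and "\<exists>\<alpha>\<in>L. Cn E {\<alpha>} = L"
    and "neg_ECQ (\<lambda>\<phi>. Op neg [\<phi>]) L E"
  shows "spECQ L E \<and> pfECQ L E"
proof -
  obtain \<alpha> where \<alpha>: "\<alpha> \<in> L" "Cn E {\<alpha>} = L"
    using assms(7) by blast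
  obtain v where v: "v \<in> V" "Var v \<noteq> \<alpha>" "Op neg [Var v] \<noteq> \<alpha>"
    using exists_fresh_Var[OF assms(2)] .
  have Var: "Var v \<in> L"
    using v(1) assms(4) by (simp add: formulas.Var)
  moreover have "Op neg [Var v] \<in> L"
    using Var assms(3,4) by (auto intro: formulas.Op)
  ultimately have "spECQ L E"
    using spECQ_if_neg_ECQ[OF assms(5,6) \<alpha> assms(8)] v(2,3) by blast
  then show ?thesis
    using spECQ_imp_pfECQ by blast
qed

end
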